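(* Let $(D,S)$ be a relational system on $A$ satisfying Condition 1 and let $R_1,\dots,R_M\subseteq A$ ($M\ge 2$) satisfy Condition 2 (both conditions are spelled out in the context). The ascending assignment rule fulfills the following properties: (a) each $w\in R_1$ is assigned to $C_1$; (b) for each $k>1$ ($2\le k\le M$), each $w\in R_k$ is assigned to a class within the range $C_{k-1}-C_k$ (that is, the rule selects $C_{k-1}$ and $C_k$ as the possible categories for $w$).
   Context: $A$ is the set of actions (all actions to be classified and all representative actions). $C=\{C_1,\dots,C_M\}$, $M\ge 2$, is a set of ordered classes, $C_M$ being the highest. Condition 1: $D$ and $S$ are binary relations on $A$ such that $D$ is transitive, $S$ is reflexive, and for all $x,y,z\in A$: $xDy\Rightarrow xSy$; ($xSy$ and $yDz$) $\Rightarrow xSz$; ($xDy$ and $ySz$) $\Rightarrow xSz$. ($S$ is also interpreted as "compatible with the order of the classes", i.e. $xSy$ is an argument for putting $x$ in a class at least as high as $y$; this is interpretive and imposes no further formal constraint.) Condition 2: each class $C_k$ is characterized by a nonempty finite set $R_k\subseteq A$ of representative actions such that (a) for $k=1,\dots,M-1$ and every $w\in R_k$ there is $z\in R_{k+1}$ with $zDw$; (b) for $k=1,\dots,M-1$ and every $w\in R_{k+1}$ there is $z\in R_k$ with $wDz$; (c) for all $1\le k<h\le M$ and every $w\in R_h$ there is no $z\in R_k$ with $zSw$. Notation: $R_kSx$ iff there is $w\in R_k$ with $wSx$. Ascending assignment rule: by convention $R_{M+1}Sx$ holds for all $x$. For $k=1,\dots,M+1$ determine the first (i.e. smallest) $k$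 such that $R_kSx$. If $k=1$, assign $x$ to $C_1$; if $k=M+1$, assign $x$ to $C_M$; if $1<k<M+1$, select $C_{k-1}$ and $C_k$ as the possible categories for $x$ ($x$ is assigned to the range $C_{k-1}-C_k$). *)

theory Defs
  imports Main
begin

text \<open>
  Relations are curried predicates; all requirements are relativised to the carrier \<open>A\<close>, so the
  values of \<open>D\<close> and \<open>S\<close> outside \<open>A\<close> are irrelevant.
\<close>

locale relational_system =
  fixes A :: "'a set" and D S :: "'a \<Rightarrow> 'a \<Rightarrow> bool"
  assumes D_trans: "transp_on A D"
    and S_refl: "reflp_on A S"
    and D_imp_S: "\<lbrakk>x \<in> A; y \<in> A; D x y\<rbrakk> \<Longrightarrow> S x y"
    and S_D_imp_S: "\<lbrakk>x \<in> A; y \<in> A; z \<in> A; S x y; D y z\<rbrakk> \<Longrightarrow> S x z"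
    and D_S_imp_S: "\<lbrakk>x \<in> A; y \<in> A; z \<in> A; D x y; S y z\<rbrakk> \<Longrightarrow> S x z"

text \<open>Only \<open>R 1, \<dots>, R M\<close> are meaningful; \<open>R\<close> is unconstrained at other indices.\<close>

locale representative_actions =
  fixes A :: "'a set" and D S :: "'a \<Rightarrow> 'a \<Rightarrow> bool"
    and M :: nat and R :: "nat \<Rightarrow> 'a set"
  assumes R_subset: "k \<in> {1..M} \<Longrightarrow> R k \<subseteq> A"
    and R_nonempty: "k \<in> {1..M} \<Longrightarrow> R k \<noteq> {}"
    and R_finite: "k \<in> {1..M} \<Longrightarrow> finite (R k)"
    and R_dominated: "\<lbrakk>1 \<le> k; k < M; w \<in> R k\<rbrakk> \<Longrightarrow> \<exists>z\<in>R (k + 1). D z w"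
    and R_dominates: "\<lbrakk>1 \<le> k; k < M; w \<in> R (k + 1)\<rbrakk> \<Longrightarrow> \<exists>z\<in>R k. D w z"
    and R_separated: "\<lbrakk>1 \<le> k; k < h; h \<le> M; w \<in> R h\<rbrakk> \<Longrightarrow> \<not> (\<exists>z\<in>R k. S z w)"

definition set_rel :: "('a \<Rightarrow> 'a \<Rightarrow> bool) \<Rightarrow> 'a set \<Rightarrow> 'a \<Rightarrow> bool" where
  "set_rel S W x \<longleftrightarrow> (\<exists>w\<in>W. S w x)"

text \<open>The disjunct \<open>k = M + 1\<close> is the convention that \<open>R (M + 1)\<close> is in relation \<open>S\<close> to every action.\<close>

definition ascending_index ::
    "('a \<Rightarrow> 'a \<Rightarrow> bool) \<Rightarrow> nat \<Rightarrow> (nat \<Rightarrow> 'a set) \<Rightarrow> 'a \<Rightarrow> nat" where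
  "ascending_index S M R x =
     (LEAST k. k \<in> {1..M + 1} \<and> (k = M + 1 \<or> set_rel S (R k) x))"

text \<open>
  The result is the set of classes selected for \<open>x\<close>: a singleton when \<open>x\<close> is assigned to a single
  class, and two consecutive classes when \<open>x\<close> is assigned to a range.
\<close>

definition ascending_assignment ::
    "('a \<Rightarrow> 'a \<Rightarrow> bool) \<Rightarrow> nat \<Rightarrow> (nat \<Rightarrow> 'c) \<Rightarrow> (nat \<Rightarrow> 'a set) \<Rightarrow> 'a \<Rightarrow> 'c set" where
  "ascending_assignment S M C R x =
     (let k = ascending_index S M R x in
      if k = 1 then {C 1}
      else if k = M + 1 then {C M}
      else {C (k - 1), C k})"

end

theory Submission
  imports Defs
begin

text \<open>The ascending rule stops exactly at \<open>k\<close> for \<open>w \<in> R k\<close>. It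
  stops no later, because reflexivity makes \<open>w\<close> itself a witness in \<open>R k\<close>;
  it stops no earlier, because \<open>R_separated\<close> forbids any action of a lower
  \<open>R j\<close> from being in relation \<open>S\<close> to \<open>w\<close>. The assigned
  classes are then read off from the index.\<close>

lemma ascending_index_representative:
  assumes "relational_system A D S" and "representative_actions A D S M R"
    and k: "1 \<le> k" "k \<le> M" and w: "w \<in> R k"
  shows "ascending_index S M R w = k"
proof -
  interpret relational_system A D S by fact
  interpret representative_actions A D S M R by fact
  have "w \<in> A"
    using R_subset[of k] k w by auto
  then have "set_rel S (R k) w"
    using S_refl w unfolding set_rel_def by (auto dest: reflp_onD)
  moreover have "\<not> set_rel S (R j) w" if "1 \<le> j" "j < k" for j
    using R_separated[OF that k(2) w] by (simp add: set_rel_def)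
  \<comment> \<open>Since \<open>k \<le> M\<close>, an index below \<open>k\<close> cannot qualify
    through the convention at \<open>M + 1\<close>, so only \<open>set_rel\<close> has to be refuted
    there.\<close>
  ultimately show ?thesis
    unfolding ascending_index_def using k
    by (intro Least_equality) (auto simp: not_less[symmetric])
qed

theorem proposition3:
  fixes A :: "'a set" and D S :: "'a \<Rightarrow> 'a \<Rightarrow> bool"
    and M :: nat and C :: "nat \<Rightarrow> 'c::linorder" and R :: "nat \<Rightarrow> 'a set"
  assumes "M \<ge> 2"
    and "strict_mono_on {1..M} C"
    and "relational_system A D S"
    and "representative_actions A D S M R"
  shows "(\<forall>w\<in>R 1. ascending_assignment S M C R w = {C 1}) \<and>
         (\<forall>k. 2 \<le> k \<and> k \<le> M \<longrightarrow>
            (\<forall>w\<in>R k. ascending_assignment S M C R w = {C (k - 1), C k}))"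
proof (intro conjI ballI allI impI)
  note index = ascending_index_representative[OF assms(3,4)]
  show "ascending_assignment S M C R w = {C 1}" if "w \<in> R 1" for w
    using index[of 1 w] that assms(1) by (simp add: ascending_assignment_def)
  show "ascending_assignment S M C R w = {C (k - 1), C k}"
    if "2 \<le> k \<and> k \<le> M" "w \<in> R k" for k w
    \<comment> \<open>The bounds \<open>2 \<le> k \<le> M\<close> exclude both one-class cases,
      \<open>k = 1\<close> and \<open>k = M + 1\<close>.\<close>
    using index[of k w] that by (simp add: ascending_assignment_def)
qed

end
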